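(* Let $\lambda$ be a nonzero real number. Let $\{T_{n}^{(3)}\}_{n\ge 0}$ be defined by $T_{0}^{(3)}=T_{1}^{(3)}=0$, $T_{2}^{(3)}=1$ and $T_{n+3}^{(3)}=T_{n+2}^{(3)}+3T_{n+1}^{(3)}+9T_{n}^{(3)}$ for $n\ge 0$. Then for all $n\ge 1$, $$T_{n}^{(3)}=\frac{1}{\lambda^{n-2}}H_{n}^{(3)}(0,0,1;\lambda,3\lambda^{2},9\lambda^{3}),$$ where $H_n^{(3)}(a,b,c;r,s,t)$ denotes the $n$-th third-order Horadam number.
   Context: For given numbers $a,b,c,r,s,t$, the third-order Horadam numbers $H_{n}^{(3)}=H_{n}^{(3)}(a,b,c;r,s,t)$, $n\ge 0$, are defined by $H_{0}^{(3)}=a$, $H_{1}^{(3)}=b$, $H_{2}^{(3)}=c$ and $H_{n+3}^{(3)}=rH_{n+2}^{(3)}+sH_{n+1}^{(3)}+tH_{n}^{(3)}$ for $n\ge 0$. The superscript $(3)$ is part of the notation, not an exponent. The exponent $n-2$ is an integer and may be negative. *)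

theory Defs
  imports Complex_Main
begin

fun horadam3 :: "'a::comm_ring_1 \<Rightarrow> 'a \<Rightarrow> 'a \<Rightarrow> 'a \<Rightarrow> 'a \<Rightarrow> 'a \<Rightarrow> nat \<Rightarrow> 'a" where
  "horadam3 a b c r s t 0 = a"
| "horadam3 a b c r s t (Suc 0) = b"
| "horadam3 a b c r s t (Suc (Suc 0)) = c"
| "horadam3 a b c r s t (Suc (Suc (Suc n))) =
     r * horadam3 a b c r s t (Suc (Suc n))
     + s * horadam3 a b c r s t (Suc n)
     + t * horadam3 a b c r s t n"

end

theory Submission
  imports Defs
begin

text \<open>A third-order recurrence and three initial values determine a sequence. Both
  \<open>lambda ^ n * T n\<close> and \<open>lambda ^ 2\<close> times the Horadam sequence of the
  theorem start with 0, 0, \<open>lambda ^ 2\<close> and obey the same recurrence, so they agree;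
  dividing by \<open>lambda ^ n\<close> gives the claim.\<close>

lemma horadam3_unique:
  fixes f :: "nat \<Rightarrow> 'a::comm_ring_1"
  assumes "f 0 = a" "f 1 = b" "f 2 = c"
    and "\<And>n. f (n + 3) = r * f (n + 2) + s * f (n + 1) + t * f n"
  shows "f n = horadam3 a b c r s t n"
  using assms
proof (induction a b c r s t n rule: horadam3.induct)
  case (4 a b c r s t n)
  from "4.IH"[OF "4.prems"] "4.prems"(4)[of n] show ?case
    by (simp add: eval_nat_numeral)
qed (simp_all add: numeral_2_eq_2)

text \<open>A term j places back lacks j factors of \<open>k\<close>, which its coefficient must
  supply.\<close>

lemma horadam3_scale:
  "horadam3 a (k * b) (k ^ 2 * c) (k * r) (k ^ 2 * s) (k ^ 3 * t) n = k ^ n * horadam3 a b c r s t n"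
  by (rule horadam3_unique[symmetric]) (auto simp: eval_nat_numeral algebra_simps)

lemma horadam3_mult_init:
  "horadam3 (d * a) (d * b) (d * c) r s t n = d * horadam3 a b c r s t n"
  by (rule horadam3_unique[symmetric]) (auto simp: eval_nat_numeral algebra_simps)

theorem proposition3p3:
  fixes lambda :: real and T :: "nat \<Rightarrow> real"
  assumes "lambda \<noteq> 0"
    and "T 0 = 0" and "T 1 = 0" and "T 2 = 1"
    and "\<And>n. T (n + 3) = T (n + 2) + 3 * T (n + 1) + 9 * T n"
  shows "\<forall>n\<ge>1. T n =
    1 / (lambda powi (int n - 2)) * horadam3 0 0 1 lambda (3 * lambda ^ 2) (9 * lambda ^ 3) n"
proof (intro allI impI)
  fix n :: nat
  let ?H = "horadam3 0 0 1 lambda (3 * lambda ^ 2) (9 * lambda ^ 3) n"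
  have "T n = horadam3 0 0 1 1 3 9 n"
    using assms by (intro horadam3_unique) auto
  \<comment> \<open>Scaling turns the initial value 1 at index 2 into \<open>lambda ^ 2\<close>,
    which linearity in the initial values pulls out.\<close>
  then have scaled: "lambda ^ n * T n = lambda ^ 2 * ?H"
    using horadam3_scale[of 0 lambda 0 1 1 3 9 n] horadam3_mult_init[of "lambda ^ 2" 0 0 1]
    by (simp add: mult.commute)
  \<comment> \<open>The exponent is negative for \<open>n\<close> below 2, so this split needs
    \<open>lambda\<close> nonzero.\<close>
  have power: "lambda powi (int n - 2) = lambda ^ n / lambda ^ 2"
    using assms(1) by (simp add: power_int_diff)
  show "T n = 1 / (lambda powi (int n - 2)) * ?H"
    unfolding power using scaled assms(1) by (simp add: field_simps)
qed

end
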